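(* Consider a $K$-armed Bernoulli bandit problem with actions $a_1,\dots,a_K$ and reward probabilities $p_1,\dots,p_K$, played by the $RS$ algorithm with constant aspiration level $R$. Let $A_U=\{a_i \mid p_i>R\}$ be the set of actions whose reward probability is greater than $R$ and $A_L=\{a_i\mid p_i<R\}$ the set of actions whose reward probability is smaller than $R$, and suppose $A_U$ is non-empty. Then, after a sufficient number of steps, a satisfactory action (an action $a_i$ with $p_i>R$) will always be chosen, and this state is stable: with probability $1$ there exists $S$ such that for all $s\ge S$ one has $\operatorname{arg\,max}_{a_i} RS(a_i,s)\in A_U$. In other words, $$P\Bigl(\operatorname*{arg\,max}_{a_i} RS(a_i,s)\in A_U\Bigr)\to 1\qquad (s\to\infty).$$
   Context: Bandit problem: there are $K$ actions $a_1,\dots,a_K$. At each step the agent chooses one action; choosing $a_i$ yields reward $1$ with probability $p_i$ and reward $0$ with probability $1-p_i$, independently over choices. The $p_i$ are unknown to the agent. Notation: after $s$ steps, $n_i(s)$ is the number of times $a_i$ has been chosen and $n_i^1(s)$ is the number of times choosing $a_i$ gave reward $1$. The mean reward is $E(a_i,s)=n_i^1(s)/n_i(s)$. $RS$ (risk-sensitive satisficing) value with aspiration level $R$ (a real number): $RS(a_i,s)=n_i(s)\,(E(a_i,s)-R)=n_i^1(s)-n_i(s)R$ (so the value is $0$ while $n_i(s)=0$). $RS$ algorithm: greedy choice with respect to the $RS$ value, i.e. after $s$ steps the next action chosen is an action maximizing $RS(\cdot,s)$. The notation $\operatorname{arg\,max}_{a_i}RS(a_i,s)$ denotes this chosen 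action.
   Formalization: If R = 0 and some p_i = 0, each action maximizing RS is assumed to be chosen with conditional probability at least a fixed ε > 0; with arbitrary tie-breaking the claim fails there (p = (0, 1/2), ties always to a_1). Elsewhere ties are arbitrary. *)

theory Defs
  imports "HOL-Probability.Probability"
begin

text \<open>
  The type \<open>'a::finite\<close> is the set of the \<open>K = CARD('a)\<close> actions. A history records, step by
  step, the chosen action and the reward obtained.
\<close>

type_synonym 'a history = "('a \<times> nat) list"

definition plays :: "'a history \<Rightarrow> 'a \<Rightarrow> nat" where
  "plays h a = length (filter (\<lambda>(b, x). b = a) h)"

definition wins :: "'a history \<Rightarrow> 'a \<Rightarrow> nat" where
  "wins h a = length (filter (\<lambda>(b, x). b = a \<and> x = 1) h)"

definition mean_reward :: "'a history \<Rightarrow> 'a \<Rightarrow> real" where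
  "mean_reward h a = real (wins h a) / real (plays h a)"

definition RS :: "real \<Rightarrow> 'a history \<Rightarrow> 'a \<Rightarrow> real" where
  "RS R h a = real (plays h a) * (mean_reward h a - R)"

definition greedy_actions :: "real \<Rightarrow> 'a history \<Rightarrow> 'a set" where
  "greedy_actions R h = {a. is_arg_max (RS R h) (\<lambda>_. True) a}"

definition satisfactory :: "('a \<Rightarrow> real) \<Rightarrow> real \<Rightarrow> 'a set" where
  "satisfactory p R = {a. p a > R}"

definition history :: "(nat \<Rightarrow> 'w \<Rightarrow> 'a) \<Rightarrow> (nat \<Rightarrow> 'w \<Rightarrow> nat) \<Rightarrow> nat \<Rightarrow> 'w \<Rightarrow> 'a history" where
  "history A X s \<omega> = map (\<lambda>t. (A t \<omega>, X t \<omega>)) [0..<s]"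

text \<open>
  \<open>A s\<close> is the action chosen after \<open>s\<close> steps and \<open>X s\<close> the reward it yields. Independence over
  choices is the requirement that, given the whole past and the action just chosen, the reward is
  Bernoulli with the parameter of that action; since histories are discrete, this conditional
  statement is expressed by products of probabilities, which also covers histories of
  probability 0. How actions are chosen is left open, so that choices may be randomized.
\<close>

locale bernoulli_bandit = prob_space M
  for M :: "'w measure" +
  fixes p :: "'a::finite \<Rightarrow> real"
    and A :: "nat \<Rightarrow> 'w \<Rightarrow> 'a"
    and X :: "nat \<Rightarrow> 'w \<Rightarrow> nat"
  assumes p_range: "\<And>a. 0 \<le> p a \<and> p a \<le> 1"
    and measurable_A: "\<And>s. A s \<in> measurable M (count_space UNIV)"
    and measurable_X: "\<And>s. X s \<in> measurable M (count_space UNIV)"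
    and reward_1: "\<And>s h a.
      prob {\<omega> \<in> space M. history A X s \<omega> = h \<and> A s \<omega> = a \<and> X s \<omega> = 1}
        = p a * prob {\<omega> \<in> space M. history A X s \<omega> = h \<and> A s \<omega> = a}"
    and reward_0: "\<And>s h a.
      prob {\<omega> \<in> space M. history A X s \<omega> = h \<and> A s \<omega> = a \<and> X s \<omega> = 0}
        = (1 - p a) * prob {\<omega> \<in> space M. history A X s \<omega> = h \<and> A s \<omega> = a}"

text \<open>Ties between maximizers of the RS value may be broken in any way, at random or not.\<close>

locale rs_bandit = bernoulli_bandit M p A X
  for M :: "'w measure" and p :: "'a::finite \<Rightarrow> real"
    and A :: "nat \<Rightarrow> 'w \<Rightarrow> 'a" and X :: "nat \<Rightarrow> 'w \<Rightarrow> nat" +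
  fixes R :: real
  assumes greedy: "\<And>s. AE \<omega> in M. A s \<omega> \<in> greedy_actions R (history A X s \<omega>)"

text \<open>
  Given any history, every maximizer is chosen with conditional probability at least a fixed
  \<open>\<epsilon> > 0\<close>. Uniformly random tie-breaking is the case \<open>\<epsilon> = 1 / CARD('a)\<close>. A condition of this kind
  is indispensable only if \<open>R = 0\<close> and some action has reward probability 0: the RS value of that
  action is constantly 0, hence maximal as long as no reward has been received, and a rule
  that resolves every tie in its favour would never choose anything else.
\<close>

definition fair_ties ::
  "'w measure \<Rightarrow> (nat \<Rightarrow> 'w \<Rightarrow> 'a) \<Rightarrow> (nat \<Rightarrow> 'w \<Rightarrow> nat) \<Rightarrow> real \<Rightarrow> bool" where
  "fair_ties M A X R \<longleftrightarrow> (\<exists>\<epsilon>>0. \<forall>s h. \<forall>a \<in> greedy_actions R h.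
     measure M {\<omega> \<in> space M. history A X s \<omega> = h \<and> A s \<omega> = a}
       \<ge> \<epsilon> * measure M {\<omega> \<in> space M. history A X s \<omega> = h})"

end

theory Submission
  imports Defs
begin

text \<open>
  For \<open>0 < R\<close>, the RS value of each action is a random walk run at the steps when the action is
  played. For \<open>p u > R\<close> its drift is positive and it is almost surely bounded below, so the maximal
  RS value never falls below some finite level. For \<open>p a \<le> R\<close> it is unbounded below if \<open>a\<close> is played
  infinitely often; but once its RS value is below that level, \<open>a\<close> is never chosen again, so \<open>a\<close> is
  chosen only finitely often. All almost sure statements come from one maximal inequality
  for supermartingale-like functions of the history. If \<open>R = 0\<close>, the first reward raises
  the value of some action in \<open>A\<^sub>U\<close> above 0, the value of every action outside \<open>A\<^sub>U\<close>; up to then all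
  actions are tied, and fair ties make the first reward come almost surely.
\<close>

section \<open>The RS value along histories\<close>

text \<open>An action that was never played has no wins either, so the default value
  \<open>0 / 0 = 0\<close> of \<open>mean_reward\<close> does no harm.\<close>

lemma RS_eq: "RS R h a = real (wins h a) - real (plays h a) * R"
proof (cases "plays h a = 0")
  case True
  then have "filter (\<lambda>(b, x). b = a) h = []"
    by (simp add: plays_def)
  then have "filter (\<lambda>(b, x). b = a \<and> x = 1) h = []"
    by (auto simp: filter_empty_conv)
  then show ?thesis
    using True by (simp add: RS_def wins_def)
next
  case False
  then show ?thesis
    by (simp add: RS_def mean_reward_def field_simps)
qed

lemma plays_Nil [simp]: "plays [] a = 0"
  by (simp add: plays_def)

lemma wins_Nil [simp]: "wins [] a = 0"
  by (simp add: wins_def)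

lemma plays_snoc [simp]: "plays (h @ [(b, x)]) a = plays h a + (if b = a then 1 else 0)"
  by (simp add: plays_def)

lemma wins_snoc [simp]: "wins (h @ [(b, x)]) a = wins h a + (if b = a \<and> x = 1 then 1 else 0)"
  by (simp add: wins_def)

lemma RS_Nil [simp]: "RS R [] a = 0"
  by (simp add: RS_eq)

lemma RS_snoc:
  "RS R (h @ [(b, x)]) a = RS R h a + (if b = a then (if x = 1 then 1 else 0) - R else 0)"
  by (simp add: RS_eq algebra_simps)

lemma length_history [simp]: "length (history A X s \<omega>) = s"
  by (simp add: history_def)

lemma history_0 [simp]: "history A X 0 \<omega> = []"
  by (simp add: history_def)

lemma history_Suc [simp]: "history A X (Suc s) \<omega> = history A X s \<omega> @ [(A s \<omega>, X s \<omega>)]"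
  by (simp add: history_def)

lemma mono_plays_history: "s \<le> t \<Longrightarrow> plays (history A X s \<omega>) a \<le> plays (history A X t \<omega>) a"
  by (induction rule: dec_induct) auto

lemma mono_wins_history: "s \<le> t \<Longrightarrow> wins (history A X s \<omega>) a \<le> wins (history A X t \<omega>) a"
  by (induction rule: dec_induct) auto

lemma plays_unbounded:
  assumes "\<And>S. \<exists>s\<ge>S. A s \<omega> = a"
  shows "\<exists>s. n \<le> plays (history A X s \<omega>) a"
proof (induction n)
  case 0
  then show ?case by simp
next
  case (Suc n)
  then obtain s where s: "n \<le> plays (history A X s \<omega>) a" by blast
  obtain t where t: "t \<ge> s" "A t \<omega> = a" using assms by blast
  have "n \<le> plays (history A X t \<omega>) a"
    using s mono_plays_history[OF t(1), of A X \<omega> a] by linarith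
  then have "Suc n \<le> plays (history A X (Suc t) \<omega>) a"
    using t(2) by simp
  then show ?case by blast
qed

lemma greedy_actions_RS_le: "a \<in> greedy_actions R h \<Longrightarrow> RS R h b \<le> RS R h a"
  by (auto simp: greedy_actions_def is_arg_max_def not_less)

text \<open>Allows measurability of \<open>H s\<close> to be checked on singletons, and almost sure
  statements to be combined over all histories.\<close>

lemma countable_histories: "countable (UNIV :: 'a::finite history set)"
proof -
  have "countable (UNIV :: ('a \<times> nat) set)"
    by (simp add: UNIV_Times_UNIV[symmetric] countable_finite del: UNIV_Times_UNIV)
  then have "countable (lists (UNIV :: ('a \<times> nat) set))"
    by (rule countable_lists)
  then show ?thesis
    by simp
qed

section \<open>Measurability and probabilities of histories, choices and rewards\<close>

context bernoulli_bandit
begin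

abbreviation H :: "nat \<Rightarrow> 'w \<Rightarrow> 'a history" where
  "H \<equiv> history A X"

text \<open>The step is read off from the length of \<open>h\<close>, since \<open>H s\<close>
  always has length \<open>s\<close>. This keeps time indices out of the drift conditions
  below.\<close>

definition history_prob :: "'a history \<Rightarrow> real" where
  "history_prob h = prob {\<omega> \<in> space M. H (length h) \<omega> = h}"

definition choice_prob :: "'a history \<Rightarrow> 'a \<Rightarrow> real" where
  "choice_prob h a = prob {\<omega> \<in> space M. H (length h) \<omega> = h \<and> A (length h) \<omega> = a}"

lemmas [measurable] = measurable_A measurable_X

lemma measurable_history [measurable]: "H s \<in> measurable M (count_space UNIV)"
proof -
  have "{\<omega> \<in> space M. H s \<omega> = h} \<in> events" for h
  proof (cases "length h = s")
    case True
    then have "{\<omega> \<in> space M. H s \<omega> = h} =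
        {\<omega> \<in> space M. \<forall>t\<in>{..<s}. A t \<omega> = fst (h ! t) \<and> X t \<omega> = snd (h ! t)}"
      by (auto simp: list_eq_iff_nth_eq history_def prod_eq_iff)
    also have "\<dots> \<in> events"
      by measurable
    finally show ?thesis .
  next
    case False
    then have "{\<omega> \<in> space M. H s \<omega> = h} = {}" by auto
    then show ?thesis by (simp only: sets.empty_sets)
  qed
  moreover have "H s -` {h} \<inter> space M = {\<omega> \<in> space M. H s \<omega> = h}" for h
    by auto
  ultimately show ?thesis
    by (simp add: measurable_count_space_eq_countable[OF countable_histories])
qed

text \<open>The reward axioms speak about one history and one action at a time; countably many null
  sets are joined here.\<close>

lemma AE_choice_reward:
  assumes null: "\<And>h a. prob {\<omega> \<in> space M. H s \<omega> = h \<and> A s \<omega> = a \<and> Q a (X s \<omega>)} = 0"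
  shows "AE \<omega> in M. \<not> Q (A s \<omega>) (X s \<omega>)"
proof -
  have "AE \<omega> in M. \<not> (H s \<omega> = h \<and> A s \<omega> = a \<and> Q a (X s \<omega>))" for h a
  proof -
    have "{\<omega> \<in> space M. H s \<omega> = h \<and> A s \<omega> = a \<and> Q a (X s \<omega>)} \<in> events"
      by measurable
    then show ?thesis
      using prob_eq_0 null[of h a] by fastforce
  qed
  then have "AE \<omega> in M. \<forall>h\<in>UNIV. \<forall>a\<in>UNIV. \<not> (H s \<omega> = h \<and> A s \<omega> = a \<and> Q a (X s \<omega>))"
    by (intro iffD2[OF AE_ball_countable] ballI countable_histories countable_finite) auto
  then show ?thesis
    by eventually_elim auto
qed

text \<open>The weights \<open>p a\<close> and \<open>1 - p a\<close> of the rewards 1 and 0 already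
  exhaust the probability of each choice, leaving mass 0 for any other reward.\<close>

lemma AE_reward_binary: "AE \<omega> in M. X s \<omega> = 0 \<or> X s \<omega> = 1"
proof -
  have "prob {\<omega> \<in> space M. H s \<omega> = h \<and> A s \<omega> = a \<and> \<not> (X s \<omega> = 0 \<or> X s \<omega> = 1)} = 0" for h a
  proof -
    let ?E = "\<lambda>P. {\<omega> \<in> space M. H s \<omega> = h \<and> A s \<omega> = a \<and> P (X s \<omega>)}"
    have m: "?E P \<in> events" for P
      by measurable
    have "prob (?E (\<lambda>_. True)) = prob ((?E (\<lambda>x. x = 1) \<union> ?E (\<lambda>x. x = 0)) \<union> ?E (\<lambda>x. \<not> (x = 0 \<or> x = 1)))"
      by (rule arg_cong[where f = prob]) auto
    also have "\<dots> = prob (?E (\<lambda>x. x = 1)) + prob (?E (\<lambda>x. x = 0)) + prob (?E (\<lambda>x. \<not> (x = 0 \<or> x = 1)))"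
      using m by (subst finite_measure_Union; (subst finite_measure_Union)?) auto
    finally show ?thesis
      using reward_1[of s h a] reward_0[of s h a] by (simp add: algebra_simps)
  qed
  then show ?thesis
    using AE_choice_reward[where Q = "\<lambda>a x. \<not> (x = 0 \<or> x = 1)"] by simp
qed

lemma AE_reward_pos: "AE \<omega> in M. \<forall>s. X s \<omega> = 1 \<longrightarrow> p (A s \<omega>) > 0"
proof -
  have "AE \<omega> in M. \<not> (p (A s \<omega>) = 0 \<and> X s \<omega> = 1)" for s
  proof (rule AE_choice_reward[where Q = "\<lambda>a x. p a = 0 \<and> x = 1"])
    fix h a
    show "prob {\<omega> \<in> space M. H s \<omega> = h \<and> A s \<omega> = a \<and> p a = 0 \<and> X s \<omega> = 1} = 0"
      using reward_1[of s h a] by (cases "p a = 0") auto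
  qed
  then have "AE \<omega> in M. \<forall>s. \<not> (p (A s \<omega>) = 0 \<and> X s \<omega> = 1)"
    by (simp add: AE_all_countable)
  then show ?thesis
    by eventually_elim (use p_range in \<open>force simp: less_le\<close>)
qed

lemma history_prob_snoc:
  "history_prob (h @ [(a, 1)]) = p a * choice_prob h a"
  "history_prob (h @ [(a, 0)]) = (1 - p a) * choice_prob h a"
  using reward_1[of "length h" h a] reward_0[of "length h" h a]
  by (simp_all add: history_prob_def choice_prob_def conj_assoc)

lemma sum_choice_prob: "(\<Sum>a\<in>UNIV. choice_prob h a) = history_prob h"
proof -
  have "history_prob h = prob (\<Union>a\<in>UNIV. {\<omega> \<in> space M. H (length h) \<omega> = h \<and> A (length h) \<omega> = a})"
    unfolding history_prob_def by (rule arg_cong[where f = prob]) auto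
  also have "\<dots> = (\<Sum>a\<in>UNIV. choice_prob h a)"
    unfolding choice_prob_def
    by (rule finite_measure_finite_Union) (auto simp: disjoint_family_on_def)
  finally show ?thesis by simp
qed

section \<open>A maximal inequality for potentials of the history\<close>

text \<open>The start \<open>k\<close> is a parameter so that the first step can be split off in an
  induction on the horizon \<open>n\<close>.\<close>

definition reach :: "('a history \<Rightarrow> real) \<Rightarrow> 'a history set \<Rightarrow> real \<Rightarrow> nat \<Rightarrow> nat \<Rightarrow> 'w \<Rightarrow> bool" where
  "reach V G C k n \<omega> \<longleftrightarrow> (\<exists>t\<le>n. C \<le> V (H (k + t) \<omega>) \<and> (\<forall>j\<le>t. H (k + j) \<omega> \<in> G))"

lemma measurable_reach [measurable]: "Measurable.pred M (reach V G C k n)"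
  unfolding reach_def by measurable

lemma reach_start: "reach V G C k n \<omega> \<Longrightarrow> H k \<omega> \<in> G"
  by (force simp: reach_def)

lemma reach_0: "reach V G C k 0 \<omega> \<Longrightarrow> C \<le> V (H k \<omega>)"
  by (auto simp: reach_def)

lemma reach_Suc:
  assumes "reach V G C k (Suc n) \<omega>" "V (H k \<omega>) < C"
  shows "reach V G C (Suc k) n \<omega>"
proof -
  obtain t where t: "t \<le> Suc n" "C \<le> V (H (k + t) \<omega>)" "\<And>j. j \<le> t \<Longrightarrow> H (k + j) \<omega> \<in> G"
    using assms(1) by (auto simp: reach_def)
  moreover from this obtain i where i: "t = Suc i"
    using assms(2) by (cases t) auto
  have "H (Suc k + j) \<omega> \<in> G" if "j \<le> i" for j
    using t(3)[of "Suc j"] that i by (simp del: history_Suc)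
  then show ?thesis
    unfolding reach_def using t i by (intro exI[of _ i]) (simp del: history_Suc)
qed

text \<open>First-step analysis replaces conditional expectations: the bound for \<open>h\<close>
  and horizon \<open>Suc n\<close> follows from the bounds for its one-step extensions and horizon
  \<open>n\<close>. Multiplying the drift condition by probabilities also covers histories of
  probability 0.\<close>

lemma prob_reach_from_le:
  assumes nonneg: "\<And>h. 0 \<le> V h" and C: "0 < C"
    and drift: "\<And>h. h \<in> G \<Longrightarrow>
      (\<Sum>a\<in>UNIV. choice_prob h a * (p a * V (h @ [(a, 1)]) + (1 - p a) * V (h @ [(a, 0)])))
        \<le> history_prob h * V h"
  shows "prob {\<omega> \<in> space M. H (length h) \<omega> = h \<and> reach V G C (length h) n \<omega>}
    \<le> history_prob h * V h / C"
proof (induction n arbitrary: h)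
  have bound: "prob {\<omega> \<in> space M. H (length h) \<omega> = h \<and> P \<omega>} \<le> history_prob h * V h / C"
    if "C \<le> V h" for h P
  proof -
    have "prob {\<omega> \<in> space M. H (length h) \<omega> = h \<and> P \<omega>} \<le> history_prob h"
      unfolding history_prob_def by (rule finite_measure_mono) auto
    also have "\<dots> \<le> history_prob h * (V h / C)"
      using that C mult_left_mono[of 1 "V h / C" "history_prob h"] by (simp add: history_prob_def)
    finally show ?thesis by simp
  qed
  have rhs_nonneg: "0 \<le> history_prob h * V h / C" for h
    using nonneg C by (simp add: history_prob_def)
  {
    case 0
    show ?case
    proof (cases "C \<le> V h")
      case False
      then have "{\<omega> \<in> space M. H (length h) \<omega> = h \<and> reach V G C (length h) 0 \<omega>} = {}"
        using reach_0[of V G C "length h"] by fastforce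
      then show ?thesis
        using rhs_nonneg by (simp only: measure_empty)
    qed (rule bound)
  next
    case (Suc n)
    let ?E = "\<lambda>h n. {\<omega> \<in> space M. H (length h) \<omega> = h \<and> reach V G C (length h) n \<omega>}"
    \<comment> \<open>Either the level is already reached and \<open>V h / C\<close> is at least 1,
      or the event is impossible, or one more step has to be made.\<close>
    consider "C \<le> V h" | "h \<notin> G" | "V h < C" "h \<in> G"
      by linarith
    then show ?case
    proof cases
      case 1
      then show ?thesis by (rule bound)
    next
      case 2
      then have "?E h (Suc n) = {}"
        using reach_start[of V G C "length h"] by fastforce
      then show ?thesis
        using rhs_nonneg by (simp only: measure_empty)
    next
      case 3
      \<comment> \<open>As rewards are almost surely 0 or 1, two extensions per action cover the
        event up to a null set.\<close>
      have "prob (?E h (Suc n)) \<le> prob (\<Union>a\<in>UNIV. ?E (h @ [(a, 1)]) n \<union> ?E (h @ [(a, 0)]) n)"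
      proof (rule finite_measure_mono_AE)
        show "AE \<omega> in M. \<omega> \<in> ?E h (Suc n) \<longrightarrow>
            \<omega> \<in> (\<Union>a\<in>UNIV. ?E (h @ [(a, 1)]) n \<union> ?E (h @ [(a, 0)]) n)"
          using AE_reward_binary[of "length h"]
        proof eventually_elim
          case (elim \<omega>)
          then show ?case
            using reach_Suc[of V G C "length h" n \<omega>] 3 by auto
        qed
      qed measurable
      also have "\<dots> \<le> (\<Sum>a\<in>UNIV. prob (?E (h @ [(a, 1)]) n \<union> ?E (h @ [(a, 0)]) n))"
        by (rule finite_measure_subadditive_finite) (auto intro!: sets.Un)
      also have "\<dots> \<le> (\<Sum>a\<in>UNIV. prob (?E (h @ [(a, 1)]) n) + prob (?E (h @ [(a, 0)]) n))"
        by (intro sum_mono measure_Un_le) auto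
      also have "\<dots> \<le> (\<Sum>a\<in>UNIV. history_prob (h @ [(a, 1)]) * V (h @ [(a, 1)]) / C
          + history_prob (h @ [(a, 0)]) * V (h @ [(a, 0)]) / C)"
        by (intro sum_mono add_mono Suc.IH)
      also have "\<dots> = (\<Sum>a\<in>UNIV. choice_prob h a *
          (p a * V (h @ [(a, 1)]) + (1 - p a) * V (h @ [(a, 0)]))) / C"
        unfolding history_prob_snoc sum_divide_distrib
        by (intro sum.cong) (simp_all add: algebra_simps flip: add_divide_distrib)
      also have "\<dots> \<le> history_prob h * V h / C"
        using drift[OF 3(2)] C by (intro divide_right_mono) auto
      finally show ?thesis .
    qed
  }
qed

text \<open>
  A form of Ville's inequality: \<open>V\<close> is a nonnegative supermartingale as long as the history
  stays in \<open>G\<close>.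
\<close>

lemma AE_potential_bounded:
  assumes nonneg: "\<And>h. 0 \<le> V h"
    and drift: "\<And>h. h \<in> G \<Longrightarrow>
      (\<Sum>a\<in>UNIV. choice_prob h a * (p a * V (h @ [(a, 1)]) + (1 - p a) * V (h @ [(a, 0)])))
        \<le> history_prob h * V h"
  shows "AE \<omega> in M. \<exists>C::nat. \<forall>s. (\<forall>t\<le>s. H t \<omega> \<in> G) \<longrightarrow> V (H s \<omega>) < real C"
proof -
  define E where "E C = {\<omega> \<in> space M. \<exists>n. reach V G C 0 n \<omega>}" for C
  have E_events [measurable]: "E C \<in> events" for C
    unfolding E_def by measurable
  have E_le: "prob (E C) \<le> V [] / C" if "0 < C" for C
  proof -
    let ?E = "\<lambda>n. {\<omega> \<in> space M. reach V G C 0 n \<omega>}"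
    have "incseq ?E"
      by (intro monoI) (auto simp: reach_def intro: order_trans)
    then have "(\<lambda>n. prob (?E n)) \<longlonglongrightarrow> prob (\<Union>n. ?E n)"
      by (intro finite_Lim_measure_incseq) auto
    moreover have "(\<Union>n. ?E n) = E C"
      by (auto simp: E_def)
    moreover have "prob (?E n) \<le> V [] / C" for n
      using prob_reach_from_le[where h = "[]" and n = n, OF nonneg that drift]
      by (simp add: history_prob_def prob_space)
    ultimately show ?thesis
      by (auto intro: LIMSEQ_le_const2)
  qed
  \<comment> \<open>On \<open>?B\<close> arbitrarily high levels are reached. Using
    \<open>Suc n\<close> keeps the levels positive, as \<open>E_le\<close> demands.\<close>
  let ?B = "\<Inter>n. E (real (Suc n))"
  have B: "?B \<in> events"
    by measurable
  have "prob ?B \<le> V [] / real (Suc n)" for n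
    by (rule order_trans[OF finite_measure_mono E_le]) auto
  moreover have "(\<lambda>n. V [] / real (Suc n)) \<longlonglongrightarrow> 0"
    by real_asymp
  ultimately have "prob ?B \<le> 0"
    by (intro LIMSEQ_le_const[of "\<lambda>n. V [] / real (Suc n)"]) auto
  then have "prob ?B = 0"
    using measure_nonneg[of M ?B] by linarith
  then have "AE \<omega> in M. \<omega> \<notin> ?B"
    using prob_eq_0[OF B] by simp
  with AE_space show ?thesis
  proof eventually_elim
    case (elim \<omega>)
    then obtain n where n: "\<And>t. \<not> reach V G (real (Suc n)) 0 t \<omega>"
      by (auto simp: E_def)
    have "V (H s \<omega>) < real (Suc n)" if "\<forall>t\<le>s. H t \<omega> \<in> G" for s
      using n[of s] that unfolding reach_def by (auto simp: not_le)
    then show ?case by blast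
  qed
qed

text \<open>If every single action has nonpositive drift, so has any mixture of actions; hence this
  form works whatever the rule of choice.\<close>

lemma AE_potential_bounded_actionwise:
  assumes nonneg: "\<And>h. 0 \<le> V h"
    and drift: "\<And>h a. h \<in> G \<Longrightarrow> p a * V (h @ [(a, 1)]) + (1 - p a) * V (h @ [(a, 0)]) \<le> V h"
  shows "AE \<omega> in M. \<exists>C::nat. \<forall>s. (\<forall>t\<le>s. H t \<omega> \<in> G) \<longrightarrow> V (H s \<omega>) < real C"
proof (rule AE_potential_bounded[OF nonneg])
  fix h assume h: "h \<in> G"
  have "(\<Sum>a\<in>UNIV. choice_prob h a * (p a * V (h @ [(a, 1)]) + (1 - p a) * V (h @ [(a, 0)])))
      \<le> (\<Sum>a\<in>UNIV. choice_prob h a * V h)"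
    using drift[OF h] by (intro sum_mono mult_left_mono) (auto simp: choice_prob_def)
  then show "(\<Sum>a\<in>UNIV. choice_prob h a * (p a * V (h @ [(a, 1)]) + (1 - p a) * V (h @ [(a, 0)])))
      \<le> history_prob h * V h"
    by (simp add: sum_distrib_right[symmetric] sum_choice_prob)
qed

section \<open>The RS value of a single action as a random walk\<close>

text \<open>The potential is \<open>exp (- \<theta> * RS)\<close>: since the increments have
  positive mean, it is a supermartingale for small positive \<open>\<theta>\<close>.\<close>

lemma AE_RS_bounded_below:
  assumes "R < p u"
  shows "AE \<omega> in M. \<exists>c::nat. \<forall>s. - real c \<le> RS R (H s \<omega>) u"
proof -
  \<comment> \<open>The expectation of \<open>exp (- \<theta> * \<xi>)\<close> for one increment
    \<open>\<xi>\<close> of the walk. It equals 1 at 0 and has negative slope there, so it is below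
    1 for some positive \<open>\<theta>\<close>.\<close>
  define g where "g \<theta> = p u * exp (- \<theta> * (1 - R)) + (1 - p u) * exp (\<theta> * R)" for \<theta> :: real
  have "(g has_real_derivative R - p u) (at 0)"
    unfolding g_def by (auto intro!: derivative_eq_intros simp: algebra_simps)
  from DERIV_neg_dec_right[OF this] obtain d where d: "0 < d" "\<And>\<theta>. 0 < \<theta> \<Longrightarrow> \<theta> < d \<Longrightarrow> g \<theta> < g 0"
    using assms by auto
  define \<theta> where "\<theta> = d / 2"
  have \<theta>: "0 < \<theta>" and g: "g \<theta> \<le> 1"
    using d(1) d(2)[of \<theta>] by (auto simp: \<theta>_def g_def)
  define V where "V h = exp (- \<theta> * RS R h u)" for h :: "'a history"
  have "AE \<omega> in M. \<exists>C::nat. \<forall>s. (\<forall>t\<le>s. H t \<omega> \<in> UNIV) \<longrightarrow> V (H s \<omega>) < real C"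
  proof (rule AE_potential_bounded_actionwise)
    fix h :: "'a history" and a
    show "0 \<le> V h"
      by (simp add: V_def)
    show "p a * V (h @ [(a, 1)]) + (1 - p a) * V (h @ [(a, 0)]) \<le> V h"
    proof (cases "a = u")
      case True
      have "V (h @ [(u, 1)]) = V h * exp (- \<theta> * (1 - R))" "V (h @ [(u, 0)]) = V h * exp (\<theta> * R)"
        by (simp_all add: V_def RS_snoc ring_distribs flip: exp_add)
      then have "p a * V (h @ [(a, 1)]) + (1 - p a) * V (h @ [(a, 0)]) = V h * g \<theta>"
        unfolding True g_def by (simp only: ring_distribs mult_ac)
      then show ?thesis
        using g by (simp add: V_def)
    qed (simp add: V_def RS_snoc algebra_simps)
  qed
  then show ?thesis
  proof eventually_elim
    case (elim \<omega>)
    then obtain C :: nat where C: "\<And>s. V (H s \<omega>) < real C" by auto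
    \<comment> \<open>Solving \<open>exp (- \<theta> * RS) < C\<close> for the RS value gives the
      lower bound \<open>- ln C / \<theta>\<close>.\<close>
    obtain c :: nat where c: "ln (real C) / \<theta> \<le> real c"
      using real_arch_simple by blast
    have "- real c \<le> RS R (H s \<omega>) u" for s
    proof -
      have "0 < real C"
        using C[of 0] by (simp add: V_def)
      then have "- \<theta> * RS R (H s \<omega>) u < ln (real C)"
        using C[of s] unfolding V_def by (metis exp_less_cancel_iff exp_ln)
      also have "\<dots> \<le> \<theta> * real c"
        using c \<theta> by (simp add: field_simps)
      finally have "\<theta> * (- real c) < \<theta> * RS R (H s \<omega>) u"
        by simp
      then show ?thesis
        using \<theta> by (simp only: mult_less_cancel_left_pos less_imp_le)
    qed
    then show ?case by blast
  qed
qed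

text \<open>The potential is the RS value shifted by \<open>c + 1\<close>. While the RS value is at
  least \<open>- c\<close>, the shifted value is at least 1 and a step lowers it by at most
  \<open>R < 1\<close>; so the truncation at 0 stays inactive and the drift is
  \<open>p a - R\<close>.\<close>

lemma AE_RS_bounded_above:
  assumes p: "p a \<le> R" and R: "0 < R" "R < 1"
  shows "AE \<omega> in M. \<exists>b::nat. \<forall>s. (\<forall>t\<le>s. - real c \<le> RS R (H t \<omega>) a) \<longrightarrow> RS R (H s \<omega>) a \<le> real b"
proof -
  define V where "V h = max 0 (RS R h a + real c + 1)" for h :: "'a history"
  define G where "G = {h. - real c \<le> RS R h a}"
  have "AE \<omega> in M. \<exists>C::nat. \<forall>s. (\<forall>t\<le>s. H t \<omega> \<in> G) \<longrightarrow> V (H s \<omega>) < real C"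
  proof (rule AE_potential_bounded_actionwise)
    fix h b
    show "0 \<le> V h"
      by (simp add: V_def)
    assume h: "h \<in> G"
    show "p b * V (h @ [(b, 1)]) + (1 - p b) * V (h @ [(b, 0)]) \<le> V h"
    proof (cases "b = a")
      case True
      have "p b * V (h @ [(b, 1)]) + (1 - p b) * V (h @ [(b, 0)]) = RS R h a + real c + 1 + (p a - R)"
        using True h R by (simp add: V_def G_def RS_snoc max_def algebra_simps)
      also have "\<dots> \<le> V h"
        using p by (simp add: V_def)
      finally show ?thesis .
    qed (simp add: V_def RS_snoc algebra_simps)
  qed
  then show ?thesis
  proof eventually_elim
    case (elim \<omega>)
    then obtain C :: nat where C: "\<And>s. (\<forall>t\<le>s. H t \<omega> \<in> G) \<Longrightarrow> V (H s \<omega>) < real C" by auto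
    have "RS R (H s \<omega>) a \<le> real C" if "\<forall>t\<le>s. - real c \<le> RS R (H t \<omega>) a" for s
      using C[of s] that by (simp add: V_def G_def)
    then show ?case by blast
  qed
qed

text \<open>
  As long as \<open>x = RS + c + 1\<close> stays in \<open>{1..K / 2}\<close>, every play of \<open>a\<close> decreases the expectation
  of the concave function \<open>x * (K - x)\<close> by at least the second moment of the increment, hence
  multiplies it by a factor of at most \<open>\<rho> < 1\<close>.
\<close>

lemma AE_plays_bounded_in_strip:
  assumes p: "p a \<le> R" and R: "0 < R" "R < 1"
  shows "AE \<omega> in M. (\<forall>s. - real c \<le> RS R (H s \<omega>) a \<and> RS R (H s \<omega>) a \<le> real b) \<longrightarrow>
    (\<exists>n. \<forall>s. plays (H s \<omega>) a \<le> n)"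
proof -
  \<comment> \<open>Both increments \<open>1 - R\<close> and \<open>- R\<close> have absolute value
    at least \<open>m\<close>, so \<open>m\<^sup>2\<close> bounds their second moment from below. On
    the strip \<open>x * (K - x)\<close> is at most \<open>K\<^sup>2\<close>, so a loss of
    \<open>m\<^sup>2\<close> is at least the fraction \<open>1 - \<rho>\<close> of it.\<close>
  define m where "m = min R (1 - R)"
  define K where "K = 2 * (real b + real c + 2)"
  define \<rho> where "\<rho> = 1 - m\<^sup>2 / K\<^sup>2"
  define q where "q x = max 0 (x * (K - x))" for x
  \<comment> \<open>The power of \<open>1 / \<rho>\<close> cancels the contraction per play. As the
    factor \<open>q\<close> is at least 1 on the strip, a bound on \<open>V\<close> there bounds the
    number of plays.\<close>
  define V where "V h = (1 / \<rho>) ^ plays h a * q (RS R h a + real c + 1)" for h :: "'a history"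
  define G where "G = {h. - real c \<le> RS R h a \<and> RS R h a \<le> real b}"
  have m: "0 < m" "m \<le> 1" and K: "4 \<le> K"
    using R by (auto simp: m_def K_def)
  have "m\<^sup>2 < K\<^sup>2"
    using m K by (intro power_strict_mono) auto
  then have \<rho>: "0 < \<rho>" "\<rho> < 1"
    using m K by (auto simp: \<rho>_def)
  have q_drift: "p a * q (x + (1 - R)) + (1 - p a) * q (x - R) \<le> \<rho> * q x"
    if x: "1 \<le> x" "x \<le> real b + real c + 1" for x
  proof -
    have q_eq: "q y = y * (K - y)" if "0 \<le> y" "y \<le> K" for y
      using that by (simp add: q_def)
    have "m\<^sup>2 \<le> (1 - R)\<^sup>2" "m\<^sup>2 \<le> R\<^sup>2"
      using R m by (auto intro!: power_mono simp: m_def)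
    then have "p a * m\<^sup>2 + (1 - p a) * m\<^sup>2 \<le> p a * (1 - R)\<^sup>2 + (1 - p a) * R\<^sup>2"
      using p_range[of a] by (intro add_mono mult_left_mono) auto
    then have var: "m\<^sup>2 \<le> p a * (1 - R)\<^sup>2 + (1 - p a) * R\<^sup>2"
      by (simp add: algebra_simps)
    \<comment> \<open>Both possible next positions lie between 0 and \<open>K\<close>, where
      \<open>q\<close> is the plain quadratic.\<close>
    have "p a * q (x + (1 - R)) + (1 - p a) * q (x - R)
        = x * (K - x) - (K - 2 * x) * (R - p a) - (p a * (1 - R)\<^sup>2 + (1 - p a) * R\<^sup>2)"
      using x R K by (subst (1 2) q_eq) (auto simp: K_def algebra_simps power2_eq_square)
    also have "\<dots> \<le> x * (K - x) - m\<^sup>2"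
    proof -
      have "0 \<le> (K - 2 * x) * (R - p a)"
        using p x by (intro mult_nonneg_nonneg) (auto simp: K_def)
      then show ?thesis
        using var by linarith
    qed
    also have "\<dots> \<le> x * (K - x) - m\<^sup>2 / K\<^sup>2 * (x * (K - x))"
    proof -
      have "x * (K - x) \<le> K * K"
        using x K by (intro mult_mono) (auto simp: K_def)
      then show ?thesis
        using m K mult_left_mono[of "x * (K - x)" "K\<^sup>2" "m\<^sup>2 / K\<^sup>2"] by (simp add: power2_eq_square)
    qed
    also have "\<dots> = \<rho> * q x"
      using x K by (subst q_eq) (auto simp: K_def \<rho>_def algebra_simps)
    finally show ?thesis .
  qed
  have "AE \<omega> in M. \<exists>C::nat. \<forall>s. (\<forall>t\<le>s. H t \<omega> \<in> G) \<longrightarrow> V (H s \<omega>) < real C"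
  proof (rule AE_potential_bounded_actionwise)
    fix h a'
    show "0 \<le> V h"
      using \<rho> by (simp add: V_def q_def)
    assume h: "h \<in> G"
    show "p a' * V (h @ [(a', 1)]) + (1 - p a') * V (h @ [(a', 0)]) \<le> V h"
    proof (cases "a' = a")
      case True
      let ?x = "RS R h a + real c + 1"
      have e: "RS R (h @ [(a, 1)]) a + real c + 1 = ?x + (1 - R)"
              "RS R (h @ [(a, 0)]) a + real c + 1 = ?x - R"
        by (simp_all add: RS_snoc)
      have "p a' * V (h @ [(a', 1)]) + (1 - p a') * V (h @ [(a', 0)])
          = (1 / \<rho>) ^ Suc (plays h a) * (p a * q (?x + (1 - R)) + (1 - p a) * q (?x - R))"
        unfolding True V_def e by (simp add: algebra_simps flip: add_divide_distrib)
      also have "\<dots> \<le> (1 / \<rho>) ^ Suc (plays h a) * (\<rho> * q ?x)"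
        using h \<rho> by (intro mult_left_mono q_drift) (auto simp: G_def)
      also have "\<dots> = V h"
        using \<rho> by (simp add: V_def)
      finally show ?thesis .
    qed (simp add: V_def RS_snoc algebra_simps)
  qed
  then show ?thesis
  proof eventually_elim
    case (elim \<omega>)
    then obtain C :: nat where C: "\<And>s. (\<forall>t\<le>s. H t \<omega> \<in> G) \<Longrightarrow> V (H s \<omega>) < real C" by auto
    obtain n where n: "real C < (1 / \<rho>) ^ n"
      using real_arch_pow[of "1 / \<rho>" "real C"] \<rho> by auto
    have "plays (H s \<omega>) a \<le> n"
      if strip: "\<forall>s. - real c \<le> RS R (H s \<omega>) a \<and> RS R (H s \<omega>) a \<le> real b" for s
    proof (rule ccontr)
      assume "\<not> plays (H s \<omega>) a \<le> n"
      then have "(1 / \<rho>) ^ n \<le> (1 / \<rho>) ^ plays (H s \<omega>) a"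
        using \<rho> by (intro power_increasing) auto
      moreover have "1 \<le> q (RS R (H s \<omega>) a + real c + 1)"
      proof -
        let ?x = "RS R (H s \<omega>) a + real c + 1"
        have "1 \<le> ?x" "1 \<le> K - ?x"
          using strip[rule_format, of s] by (auto simp: K_def)
        then have "1 * 1 \<le> ?x * (K - ?x)"
          by (intro mult_mono) auto
        then show ?thesis
          by (simp add: q_def)
      qed
      ultimately have "(1 / \<rho>) ^ n * 1 \<le> V (H s \<omega>)"
        unfolding V_def using \<rho> by (intro mult_mono) auto
      then show False
        using n C[of s] strip by (simp add: G_def)
    qed
    then show ?case by blast
  qed
qed

text \<open>A walk that stays above \<open>- c\<close> is also bounded above, hence confined to a
  strip, where only finitely many plays fit. All \<open>c\<close> are treated on one almost sure
  event because the level used later depends on \<open>\<omega>\<close>.\<close>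

lemma AE_plays_bounded_or_RS_unbounded_below:
  assumes p: "p a \<le> R" and R: "0 < R" "R < 1"
  shows "AE \<omega> in M. \<forall>c::nat. (\<exists>n. \<forall>s. plays (H s \<omega>) a \<le> n) \<or> (\<exists>s. RS R (H s \<omega>) a < - real c)"
proof -
  have "AE \<omega> in M. \<forall>c::nat. \<exists>b::nat. \<forall>s. (\<forall>t\<le>s. - real c \<le> RS R (H t \<omega>) a) \<longrightarrow> RS R (H s \<omega>) a \<le> real b"
    using AE_RS_bounded_above[OF assms] by (simp add: AE_all_countable)
  moreover have "AE \<omega> in M. \<forall>c b::nat. (\<forall>s. - real c \<le> RS R (H s \<omega>) a \<and> RS R (H s \<omega>) a \<le> real b) \<longrightarrow>
      (\<exists>n. \<forall>s. plays (H s \<omega>) a \<le> n)"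
    unfolding AE_all_countable using AE_plays_bounded_in_strip[OF assms] by blast
  ultimately show ?thesis
    by eventually_elim (metis not_le)
qed

section \<open>The first reward at aspiration level 0\<close>

text \<open>Before the first reward all RS values are 0, so \<open>u\<close> is among the tied
  maximizers and each step yields a reward with conditional probability at least
  \<open>\<delta>\<close>. The waiting time thus has a geometric tail, encoded by the growth of
  \<open>V\<close> up to the first reward.\<close>

lemma AE_win_of_fair_ties:
  assumes fair: "fair_ties M A X 0" and u: "0 < p u"
  shows "AE \<omega> in M. \<exists>s a. 0 < wins (H s \<omega>) a"
proof -
  obtain \<epsilon> where \<epsilon>: "0 < \<epsilon>" and tie: "\<And>s h a. a \<in> greedy_actions 0 h \<Longrightarrow>
      \<epsilon> * prob {\<omega> \<in> space M. H s \<omega> = h} \<le> prob {\<omega> \<in> space M. H s \<omega> = h \<and> A s \<omega> = a}"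
    using fair unfolding fair_ties_def by blast
  \<comment> \<open>The minimum with 1/2 keeps \<open>1 - \<delta>\<close> positive, so that it can
    be divided by.\<close>
  define \<delta> where "\<delta> = min \<epsilon> (1 / 2) * p u"
  have "min \<epsilon> (1 / 2) * p u \<le> 1 / 2 * 1"
    using p_range[of u] \<epsilon> by (intro mult_mono) auto
  then have \<delta>: "0 < \<delta>" "\<delta> < 1"
    using u \<epsilon> by (auto simp: \<delta>_def)
  define V where "V h = (if \<forall>a. wins h a = 0 then (1 / (1 - \<delta>)) ^ length h else 0)" for h :: "'a history"
  have "AE \<omega> in M. \<exists>C::nat. \<forall>s. (\<forall>t\<le>s. H t \<omega> \<in> UNIV) \<longrightarrow> V (H s \<omega>) < real C"
  proof (rule AE_potential_bounded)
    fix h :: "'a history"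
    show "0 \<le> V h"
      using \<delta> by (simp add: V_def)
    show "(\<Sum>a\<in>UNIV. choice_prob h a * (p a * V (h @ [(a, 1)]) + (1 - p a) * V (h @ [(a, 0)])))
        \<le> history_prob h * V h"
    proof (cases "\<forall>a. wins h a = 0")
      case True
      have "V (h @ [(a, 1)]) = 0" for a
        by (auto simp: V_def intro: exI[of _ a])
      moreover have "V (h @ [(a, 0)]) = V h / (1 - \<delta>)" for a
        using True by (simp add: V_def)
      ultimately have "(\<Sum>a\<in>UNIV. choice_prob h a * (p a * V (h @ [(a, 1)]) + (1 - p a) * V (h @ [(a, 0)])))
          = (\<Sum>a\<in>UNIV. choice_prob h a - choice_prob h a * p a) * (V h / (1 - \<delta>))"
        unfolding sum_distrib_right by (intro sum.cong) (simp_all add: algebra_simps flip: add_divide_distrib)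
      also have "\<dots> \<le> (history_prob h * (1 - \<delta>)) * (V h / (1 - \<delta>))"
      proof (rule mult_right_mono)
        have "u \<in> greedy_actions 0 h"
          using True by (simp add: greedy_actions_def is_arg_max_def RS_eq)
        from tie[OF this, of "length h"] have "\<epsilon> * history_prob h \<le> choice_prob h u"
          by (simp add: history_prob_def choice_prob_def)
        moreover have "min \<epsilon> (1 / 2) * history_prob h \<le> \<epsilon> * history_prob h"
          by (intro mult_right_mono) (auto simp: history_prob_def)
        ultimately have "min \<epsilon> (1 / 2) * history_prob h * p u \<le> choice_prob h u * p u"
          using u by (intro mult_right_mono) auto
        then have "\<delta> * history_prob h \<le> choice_prob h u * p u"
          by (simp add: \<delta>_def algebra_simps)
        also have "\<dots> \<le> (\<Sum>a\<in>UNIV. choice_prob h a * p a)"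
          using p_range by (intro member_le_sum) (auto simp: choice_prob_def)
        finally show "(\<Sum>a\<in>UNIV. choice_prob h a - choice_prob h a * p a) \<le> history_prob h * (1 - \<delta>)"
          by (simp add: sum_subtractf sum_choice_prob algebra_simps)
      qed (use \<delta> in \<open>simp add: V_def\<close>)
      finally show ?thesis
        using \<delta> by simp
    next
      case False
      then have "V (h @ [(a, x)]) = 0" for a x
        by (auto simp: V_def)
      moreover have "V h = 0"
        using False by (auto simp: V_def)
      ultimately show ?thesis
        by (simp only: mult_zero_right add_0_right sum.neutral_const order_refl)
    qed
  qed
  then show ?thesis
  proof eventually_elim
    case (elim \<omega>)
    then obtain C :: nat where C: "\<And>s. V (H s \<omega>) < real C" by auto
    obtain n where n: "real C < (1 / (1 - \<delta>)) ^ n"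
      using real_arch_pow[of "1 / (1 - \<delta>)" "real C"] \<delta> by auto
    show ?case
    proof (rule ccontr)
      assume "\<not> ?thesis"
      then have "V (H n \<omega>) = (1 / (1 - \<delta>)) ^ n"
        by (simp add: V_def)
      then show False
        using n C[of n] by simp
    qed
  qed
qed

end

section \<open>Consequences of the greedy choice\<close>

context rs_bandit
begin

lemma AE_greedy: "AE \<omega> in M. \<forall>s b. RS R (H s \<omega>) b \<le> RS R (H s \<omega>) (A s \<omega>)"
proof -
  have "AE \<omega> in M. \<forall>s. A s \<omega> \<in> greedy_actions R (H s \<omega>)"
    using greedy by (simp add: AE_all_countable)
  then show ?thesis
    by eventually_elim (auto intro: greedy_actions_RS_le)
qed

lemma AE_eventually_satisfactory_pos:
  assumes R: "0 < R" and nonempty: "satisfactory p R \<noteq> {}"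
  shows "AE \<omega> in M. \<exists>S. \<forall>s\<ge>S. A s \<omega> \<in> satisfactory p R"
proof -
  obtain u where u: "R < p u"
    using nonempty by (auto simp: satisfactory_def)
  then have R1: "R < 1"
    using p_range[of u] by linarith
  have "AE \<omega> in M. \<forall>a\<in>- satisfactory p R. \<forall>c::nat.
      (\<exists>n. \<forall>s. plays (H s \<omega>) a \<le> n) \<or> (\<exists>s. RS R (H s \<omega>) a < - real c)"
    using AE_plays_bounded_or_RS_unbounded_below R R1
    by (intro AE_finite_allI) (auto simp: satisfactory_def not_less)
  with AE_RS_bounded_below[OF u] AE_greedy show ?thesis
  proof eventually_elim
    case (elim \<omega>)
    from elim(1) obtain c :: nat where c: "\<And>s. - real c \<le> RS R (H s \<omega>) u" by blast
    have "\<forall>\<^sub>F s in sequentially. A s \<omega> \<noteq> a" if a: "a \<in> - satisfactory p R" for a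
    proof -
      from elim(3) a consider n where "\<And>s. plays (H s \<omega>) a \<le> n" | s where "RS R (H s \<omega>) a < - real c"
        by blast
      then show ?thesis
      proof cases
        case 1
        have "\<exists>S. \<forall>s\<ge>S. A s \<omega> \<noteq> a"
          using plays_unbounded[of A \<omega> a "Suc n" X] 1 by (metis not_less_eq_eq)
        then show ?thesis
          by (simp add: eventually_sequentially)
      next
        case 2
        \<comment> \<open>Below the floor \<open>- c\<close> of the RS value of \<open>u\<close>,
          the action \<open>a\<close> is not a maximizer.\<close>
        have ne: "A t \<omega> \<noteq> a" if "RS R (H t \<omega>) a < - real c" for t
          using elim(2)[rule_format, of t u] c[of t] that by auto
        \<comment> \<open>An action that is not chosen keeps its RS value, so \<open>a\<close>
          remains below the floor forever.\<close>
        have "RS R (H t \<omega>) a < - real c" if "s \<le> t" for t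
          using that
        proof (induction rule: dec_induct)
          case (step t)
          then show ?case
            using ne[of t] by (simp add: RS_snoc)
        qed (use 2 in simp)
        then show ?thesis
          using ne unfolding eventually_sequentially by blast
      qed
    qed
    then have "\<forall>\<^sub>F s in sequentially. \<forall>a\<in>- satisfactory p R. A s \<omega> \<noteq> a"
      by (intro eventually_ball_finite) auto
    then show ?case
      unfolding eventually_sequentially by blast
  qed
qed

text \<open>With \<open>R = 0\<close> the RS value is the number of wins. After the first reward the
  maximum is positive, and almost surely only actions of positive reward probability ever
  win.\<close>

lemma AE_eventually_satisfactory_zero:
  assumes R: "R = 0" and nonempty: "satisfactory p R \<noteq> {}" and fair: "fair_ties M A X 0"
  shows "AE \<omega> in M. \<exists>S. \<forall>s\<ge>S. A s \<omega> \<in> satisfactory p R"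
proof -
  obtain u where u: "0 < p u"
    using nonempty R by (auto simp: satisfactory_def)
  from AE_win_of_fair_ties[OF fair u] AE_reward_pos AE_greedy show ?thesis
  proof eventually_elim
    case (elim \<omega>)
    then obtain S b where S: "0 < wins (H S \<omega>) b" by blast
    have zero: "wins (H s \<omega>) a = 0" if "\<not> 0 < p a" for s a
      by (induction s) (use elim(2) that in auto)
    have "0 < p (A s \<omega>)" if "S \<le> s" for s
    proof -
      have "0 < wins (H s \<omega>) b"
        using S mono_wins_history[OF that, of A X \<omega> b] by linarith
      also have "wins (H s \<omega>) b \<le> wins (H s \<omega>) (A s \<omega>)"
        using elim(3)[rule_format, of s b] R by (simp add: RS_eq)
      finally show ?thesis
        using zero[of "A s \<omega>" s] by auto
    qed
    then show ?case
      using R by (auto simp: satisfactory_def)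
  qed
qed

end

section \<open>From almost sure stability to convergence of probabilities\<close>

text \<open>The events that \<open>P\<close> holds from \<open>S\<close> on increase to an event of
  probability 1, and each lies inside the event that \<open>P\<close> holds at
  \<open>S\<close>.\<close>

lemma (in prob_space) AE_eventually_imp_prob_tendsto_1:
  assumes [measurable]: "\<And>s::nat. Measurable.pred M (P s)"
    and ev: "AE \<omega> in M. \<exists>S. \<forall>s\<ge>S. P s \<omega>"
  shows "(\<lambda>s. prob {\<omega> \<in> space M. P s \<omega>}) \<longlonglongrightarrow> 1"
proof (rule tendsto_sandwich)
  let ?B = "\<lambda>S. {\<omega> \<in> space M. \<forall>s\<in>{S..}. P s \<omega>}"
  have "incseq ?B"
    by (intro monoI) auto
  then have "(\<lambda>S. prob (?B S)) \<longlonglongrightarrow> prob (\<Union>S. ?B S)"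
    by (intro finite_Lim_measure_incseq) auto
  moreover have "prob (\<Union>S. ?B S) = 1"
  proof (subst prob_eq_1)
    show "AE \<omega> in M. \<omega> \<in> (\<Union>S. ?B S)"
      using ev AE_space by eventually_elim auto
  qed measurable
  ultimately show "(\<lambda>S. prob (?B S)) \<longlonglongrightarrow> 1"
    by simp
  show "\<forall>\<^sub>F s in sequentially. prob (?B s) \<le> prob {\<omega> \<in> space M. P s \<omega>}"
    by (intro always_eventually allI finite_measure_mono) auto
qed auto

theorem proposition1:
  fixes M :: "'w measure"
    and p :: "'a::finite \<Rightarrow> real"
    and A :: "nat \<Rightarrow> 'w \<Rightarrow> 'a"
    and X :: "nat \<Rightarrow> 'w \<Rightarrow> nat"
    and R :: real
  assumes bandit: "rs_bandit M p A X R"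
    and nonempty: "satisfactory p R \<noteq> {}"
    and degenerate: "R = 0 \<and> (\<exists>a. p a = 0) \<Longrightarrow> fair_ties M A X R"
  shows "(AE \<omega> in M. \<exists>S. \<forall>s\<ge>S. A s \<omega> \<in> satisfactory p R)
    \<and> (\<lambda>s. measure M {\<omega> \<in> space M. A s \<omega> \<in> satisfactory p R}) \<longlonglongrightarrow> 1"
proof -
  interpret rs_bandit M p A X R
    by (rule bandit)
  have "AE \<omega> in M. \<exists>S. \<forall>s\<ge>S. A s \<omega> \<in> satisfactory p R"
  proof -
    \<comment> \<open>In the last case, that is for \<open>R < 0\<close> or for \<open>R = 0\<close>
      with all reward probabilities positive, every action is satisfactory.\<close>
    consider "0 < R" | "R = 0" "\<exists>a. p a = 0" | "\<And>a. R < p a"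
      using p_range by (metis less_eq_real_def linorder_less_linear order_less_le_trans)
    then show ?thesis
    proof cases
      case 1
      then show ?thesis
        using nonempty by (rule AE_eventually_satisfactory_pos)
    next
      case 2
      then show ?thesis
        using nonempty degenerate by (intro AE_eventually_satisfactory_zero) auto
    next
      case 3
      then show ?thesis
        by (simp add: satisfactory_def)
    qed
  qed
  then show ?thesis
    by (intro conjI AE_eventually_imp_prob_tendsto_1) auto
qed

end
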